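(* Let $\mathcal{H}_1,\mathcal{H}_2$ be real or complex Hilbert spaces, $A,B\in\mathcal{B}(\mathcal{H}_1,\mathcal{H}_2)$, $M=\mathcal{H}_1\oplus\{0\}$, $N=\mathcal{H}_2\oplus\{0\}$, and let $T=\begin{pmatrix} A & A \\ A & A+B \end{pmatrix}\in\mathcal{B}(\mathcal{H}_1\oplus\mathcal{H}_1,\mathcal{H}_2\oplus\mathcal{H}_2)$ be $(M,N)$-complementable. If $A^*(2A+B)=0$, then for every $x\in M$ the parallel sum $A:B$ satisfies $$\|(A:B)x\|\ge\|Tx\|.$$
   Context: $\mathcal{R}(\cdot)$, $\mathcal{N}(\cdot)$ denote range and null space. $T$ is $(M,N)$-complementable precisely when $\mathcal{R}(A)\subseteq\mathcal{R}(A+B)$ and $\mathcal{R}(A^* )\subseteq\mathcal{R}(A^*+B^* )$, i.e. $A$ and $B$ are parallel summable. If $\mathcal{R}(A_1)\subseteq\mathcal{R}(B_1)$ for bounded operators $A_1,B_1$ with the same codomain, the Douglas reduced solution of $A_1=B_1X$ is the unique bounded $C_1$ with $A_1=B_1C_1$ and $\mathcal{R}(C_1)\subseteq\mathcal{N}(B_1)^\perp$. The parallel sum $A:B\in\mathcal{B}(\mathcal{H}_1,\mathcal{H}_2)$ is the $(1,1)$ entry of the Schur complement $T_{/(M,N)}=\begin{pmatrix} A:B & 0 \\ 0 & 0 \end{pmatrix}$, that is, $A:B=A-AZ=A-YA$, where $Z$ is the Douglas reduced solution of $A=(A+B)X$ and $Y^*$ is the Douglas reduced solution of $A^*=(A+B)^*X$.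 For $x=(x_1,0)\in M$, $(A:B)x$ means $(A:B)x_1$ (equivalently $T_{/(M,N)}x$). *)

theory Defs
  imports "HOL-Analysis.Analysis"
begin

section \<open>Real or complex scalars\<close>

text \<open>
  The axioms force every \<open>z\<close> to be a root of the real polynomial
  \<open>X^2 - (z + kconj z) X + (norm z)^2\<close>, so up to isomorphism the only instances are the
  reals (with trivial conjugation) and the complex numbers (with the usual one).
\<close>

class real_or_complex = real_normed_field +
  fixes kconj :: "'a \<Rightarrow> 'a"
  assumes kconj_add: "kconj (x + y) = kconj x + kconj y"
    and kconj_mult: "kconj (x * y) = kconj x * kconj y"
    and mult_kconj: "x * kconj x = (norm x)\<^sup>2 *\<^sub>R 1"

instantiation real :: real_or_complex
begin
definition kconj_real :: "real \<Rightarrow> real" where "kconj_real x = x"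
instance by standard (simp_all add: kconj_real_def power2_eq_square)
end

instantiation complex :: real_or_complex
begin
definition kconj_complex :: "complex \<Rightarrow> complex" where "kconj_complex = cnj"
instance
proof
  fix x y :: complex
  show "x * kconj x = (norm x)\<^sup>2 *\<^sub>R 1"
    unfolding kconj_complex_def scaleR_conv_of_real mult_1_right complex_norm_square ..
qed (simp_all add: kconj_complex_def)
end

section \<open>Hilbert spaces and bounded operators\<close>

text \<open>
  A Hilbert space over \<open>'k\<close> is a \<open>banach\<close> type (whose class provides the norm and completeness)
  with a \<open>'k\<close>-vector space structure extending the real one and a \<open>'k\<close>-valued inner product,
  linear in the first argument, that induces the norm.
\<close>

locale hilbert_space = vector_space scale
  for scale :: "'k::real_or_complex \<Rightarrow> 'a::banach \<Rightarrow> 'a" +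
  fixes ip :: "'a \<Rightarrow> 'a \<Rightarrow> 'k"
  assumes scale_of_real: "scale (of_real r) x = r *\<^sub>R x"
    and ip_add_left: "ip (x + y) z = ip x z + ip y z"
    and ip_scale_left: "ip (scale c x) y = c * ip x y"
    and ip_commute: "ip y x = kconj (ip x y)"
    and ip_norm: "ip x x = of_real ((norm x)\<^sup>2)"

lemma hilbert_space_real:
  "hilbert_space scaleR (inner :: 'a::{real_inner, banach} \<Rightarrow> 'a \<Rightarrow> real)"
proof unfold_locales
  fix x :: 'a
  show "inner x x = of_real ((norm x)\<^sup>2)"
    by (simp add: power2_norm_eq_inner)
qed (auto simp: scaleR_add_right scaleR_add_left inner_add_left kconj_real_def intro: inner_commute)

lemma hilbert_space_complex:
  "hilbert_space (*) (\<lambda>x y :: complex. x * cnj y)"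
proof unfold_locales
  fix x :: complex
  show "x * cnj x = of_real ((norm x)\<^sup>2)"
    unfolding complex_norm_square ..
qed (auto simp: ring_distribs kconj_complex_def scaleR_conv_of_real)

definition bounded_op ::
  "('k \<Rightarrow> 'a::real_normed_vector \<Rightarrow> 'a) \<Rightarrow> ('k \<Rightarrow> 'b::real_normed_vector \<Rightarrow> 'b)
    \<Rightarrow> ('a \<Rightarrow> 'b) \<Rightarrow> bool"
  where "bounded_op s1 s2 A \<longleftrightarrow> bounded_linear A \<and> (\<forall>c x. A (s1 c x) = s2 c (A x))"

definition adj :: "('a \<Rightarrow> 'a \<Rightarrow> 'k) \<Rightarrow> ('b \<Rightarrow> 'b \<Rightarrow> 'k) \<Rightarrow> ('a \<Rightarrow> 'b) \<Rightarrow> 'b \<Rightarrow> 'a"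
  where "adj ip1 ip2 A = (THE A'. \<forall>x y. ip2 (A x) y = ip1 x (A' y))"

definition null_space :: "('a \<Rightarrow> 'b::zero) \<Rightarrow> 'a set"
  where "null_space A = {x. A x = 0}"

definition orth_compl :: "('a \<Rightarrow> 'a \<Rightarrow> 'k::zero) \<Rightarrow> 'a set \<Rightarrow> 'a set"
  where "orth_compl ip S = {x. \<forall>y\<in>S. ip x y = 0}"

text \<open>
  The reduced solution of \<open>A1 = B1 X\<close> for \<open>A1 : G \<rightarrow> K\<close>, \<open>B1 : H \<rightarrow> K\<close>. The scalar
  multiplications are those of \<open>G\<close> and \<open>H\<close>, the inner product is that of \<open>H\<close>. It is meaningful
  only if the range of \<open>A1\<close> is contained in that of \<open>B1\<close>.
\<close>

definition douglas_solution ::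
  "('k \<Rightarrow> 'g::real_normed_vector \<Rightarrow> 'g) \<Rightarrow> ('k \<Rightarrow> 'h::real_normed_vector \<Rightarrow> 'h)
    \<Rightarrow> ('h \<Rightarrow> 'h \<Rightarrow> 'k::zero) \<Rightarrow> ('h \<Rightarrow> 'l::zero) \<Rightarrow> ('g \<Rightarrow> 'l) \<Rightarrow> 'g \<Rightarrow> 'h"
  where "douglas_solution sG sH ipH B1 A1 =
    (THE C. bounded_op sG sH C \<and> A1 = B1 \<circ> C \<and> range C \<subseteq> orth_compl ipH (null_space B1))"

section \<open>Block operators, complementability, Schur complement\<close>

text \<open>
  The direct sum of two Hilbert spaces is the product type; its library norm
  \<open>sqrt ((norm x)^2 + (norm y)^2)\<close> is the direct sum norm. Block entries, complementability and
  Schur complements are always taken with respect to \<open>M = UNIV \<times> {0}\<close> in the domain and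
  \<open>N = UNIV \<times> {0}\<close> in the codomain.
\<close>

definition block_op ::
  "('a \<Rightarrow> 'b::plus) \<Rightarrow> ('c \<Rightarrow> 'b) \<Rightarrow> ('a \<Rightarrow> 'd::plus) \<Rightarrow> ('c \<Rightarrow> 'd) \<Rightarrow> 'a \<times> 'c \<Rightarrow> 'b \<times> 'd"
  where "block_op T11 T12 T21 T22 = (\<lambda>(x, y). (T11 x + T12 y, T21 x + T22 y))"

definition entry11 :: "('a \<times> 'c::zero \<Rightarrow> 'b \<times> 'd) \<Rightarrow> 'a \<Rightarrow> 'b"
  where "entry11 T x = fst (T (x, 0))"

definition entry12 :: "('a::zero \<times> 'c \<Rightarrow> 'b \<times> 'd) \<Rightarrow> 'c \<Rightarrow> 'b"
  where "entry12 T y = fst (T (0, y))"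

definition entry21 :: "('a \<times> 'c::zero \<Rightarrow> 'b \<times> 'd) \<Rightarrow> 'a \<Rightarrow> 'd"
  where "entry21 T x = snd (T (x, 0))"

definition entry22 :: "('a::zero \<times> 'c \<Rightarrow> 'b \<times> 'd) \<Rightarrow> 'c \<Rightarrow> 'd"
  where "entry22 T y = snd (T (0, y))"

definition complementable ::
  "('b \<Rightarrow> 'b \<Rightarrow> 'k) \<Rightarrow> ('c \<Rightarrow> 'c \<Rightarrow> 'k) \<Rightarrow> ('d \<Rightarrow> 'd \<Rightarrow> 'k)
    \<Rightarrow> ('a::zero \<times> 'c::zero \<Rightarrow> 'b \<times> 'd) \<Rightarrow> bool"
  where "complementable ipb ipc ipd T \<longleftrightarrow>
    range (entry21 T) \<subseteq> range (entry22 T) \<and>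
    range (adj ipc ipb (entry12 T)) \<subseteq> range (adj ipc ipd (entry22 T))"

definition schur_complement ::
  "('k \<Rightarrow> 'a::real_normed_vector \<Rightarrow> 'a) \<Rightarrow> ('k \<Rightarrow> 'c::real_normed_vector \<Rightarrow> 'c)
    \<Rightarrow> ('c \<Rightarrow> 'c \<Rightarrow> 'k::zero) \<Rightarrow> ('a \<times> 'c \<Rightarrow> 'b::ab_group_add \<times> 'd::ab_group_add)
    \<Rightarrow> 'a \<times> 'c \<Rightarrow> 'b \<times> 'd"
  where "schur_complement sa sc ipc T =
    block_op (\<lambda>x. entry11 T x - entry12 T (douglas_solution sa sc ipc (entry22 T) (entry21 T) x))
      (\<lambda>_. 0) (\<lambda>_. 0) (\<lambda>_. 0)"

section \<open>Parallel sum\<close>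

definition parallel_block ::
  "('a \<Rightarrow> 'b::ab_group_add) \<Rightarrow> ('a \<Rightarrow> 'b) \<Rightarrow> 'a \<times> 'a \<Rightarrow> 'b \<times> 'b"
  where "parallel_block A B = block_op A A A (\<lambda>x. A x + B x)"

definition parallel_sum ::
  "('k \<Rightarrow> 'a::real_normed_vector \<Rightarrow> 'a) \<Rightarrow> ('a \<Rightarrow> 'a \<Rightarrow> 'k::zero)
    \<Rightarrow> ('a \<Rightarrow> 'b::ab_group_add) \<Rightarrow> ('a \<Rightarrow> 'b) \<Rightarrow> 'a \<Rightarrow> 'b"
  where "parallel_sum s ip A B = entry11 (schur_complement s s ip (parallel_block A B))"

lemma entries_parallel_block:
  assumes "A 0 = 0" "B 0 = 0"
  shows "entry11 (parallel_block A B) = A" "entry12 (parallel_block A B) = A"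
    "entry21 (parallel_block A B) = A" "entry22 (parallel_block A B) = (\<lambda>x. A x + B x)"
  using assms
  by (auto simp: fun_eq_iff parallel_block_def block_op_def entry11_def entry12_def
      entry21_def entry22_def)

lemma complementable_parallel_block:
  assumes "A 0 = 0" "B 0 = 0"
  shows "complementable ip2 ip1 ip2 (parallel_block A B) \<longleftrightarrow>
    range A \<subseteq> range (\<lambda>x. A x + B x) \<and>
    range (adj ip1 ip2 A) \<subseteq> range (adj ip1 ip2 (\<lambda>x. A x + B x))"
  by (simp add: complementable_def entries_parallel_block[of A B, OF assms])

lemma parallel_sum_eq:
  assumes "A 0 = 0" "B 0 = 0"
  shows "parallel_sum s ip A B x = A x - A (douglas_solution s s ip (\<lambda>x. A x + B x) A x)"
  by (simp add: parallel_sum_def schur_complement_def entries_parallel_block[of A B, OF assms])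
    (simp add: entry11_def block_op_def)

lemma schur_complement_parallel_block:
  "schur_complement s s ip (parallel_block A B) (x, y) = (parallel_sum s ip A B x, 0)"
  by (simp add: parallel_sum_def schur_complement_def entry11_def block_op_def)

end

theory Submission imports Defs begin

text \<open>
  Put \<open>S = A + B\<close> and let \<open>Z\<close> be the reduced solution of \<open>A = S X\<close>. The hypothesis says
  \<open>A\<^sup>* (A + S) = 0\<close>. Applying it to \<open>Z x\<close> and using \<open>S Z = A\<close> gives \<open>A\<^sup>* A (Z x + x) = 0\<close>, and since
  \<open>A\<^sup>*\<close> is injective on the range of \<open>A\<close>, this means \<open>A Z x = - A x\<close>. Hence the parallel
  sum is \<open>A - A Z = 2 A\<close>. On the other hand the block operator maps \<open>(x, 0)\<close> to \<open>(A x, A x)\<close>, a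
  vector of norm \<open>sqrt 2 * norm (A x)\<close>, and the inequality becomes \<open>2 \<ge> sqrt 2\<close>.

  The algebra is short, but both the adjoint and the reduced solution are given by definite
  descriptions, so each has to be shown to exist and to be unique. For the adjoint this is the
  Riesz representation theorem (\<open>Riesz_representation\<close>, \<open>ip_adj\<close>), which rests on the orthogonal
  projection onto a closed subspace. For the reduced solution it is Douglas's
  theorem (\<open>douglas_solution_ex1\<close>): the solution is forced pointwise, which makes it linear; its
  boundedness comes from the uniform boundedness principle. The functionals
  \<open>x \<mapsto> \<langle>A x, y\<rangle> = \<langle>Z x, S\<^sup>* y\<rangle>\<close> with \<open>norm (S\<^sup>* y) \<le> 1\<close> are continuous, because \<open>A\<close> is, and bounded
  at each point \<open>x\<close> by \<open>norm (Z x)\<close>; a common bound for them bounds \<open>Z\<close>, because the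
  range of \<open>S\<^sup>*\<close> is dense in the orthogonal complement of the null space of \<open>S\<close>.
\<close>

section \<open>The scalar conjugation\<close>

lemma kconj_of_real [simp]: "kconj (of_real r :: 'k::real_or_complex) = of_real r"
proof (cases "r = 0")
  case True
  have "kconj (0::'k) + kconj 0 = kconj 0"
    using kconj_add[of "0::'k" 0] by simp
  with True show ?thesis by simp
next
  case False
  have "of_real r * kconj (of_real r :: 'k) = of_real r * of_real r"
    by (simp add: mult_kconj scaleR_conv_of_real power2_eq_square)
  with False show ?thesis by simp
qed

lemma kconj_0 [simp]: "kconj (0::'k::real_or_complex) = 0"
  using kconj_of_real[of 0, where 'k='k] by simp

lemma kconj_kconj [simp]: "kconj (kconj x) = (x::'k::real_or_complex)"
proof (cases "x = 0")
  case False
  have *: "y * kconj y = of_real ((norm y)\<^sup>2)" for y :: 'k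
    by (simp add: mult_kconj scaleR_conv_of_real)
  have "kconj x * kconj (kconj x) = kconj (x * kconj x)"
    by (simp only: kconj_mult)
  also have "\<dots> = x * kconj x"
    by (simp only: * kconj_of_real)
  finally have "kconj x * (kconj (kconj x) - x) = 0"
    by (simp add: algebra_simps)
  moreover have "kconj x \<noteq> 0"
    using *[of x] False by auto
  ultimately show ?thesis by simp
qed simp

section \<open>Geometry of a Hilbert space\<close>

context hilbert_space
begin

lemma ip_add_right: "ip x (y + z) = ip x y + ip x z"
  by (metis ip_commute ip_add_left kconj_add)

lemma ip_scale_right: "ip x (scale c y) = kconj c * ip x y"
  by (metis ip_commute ip_scale_left kconj_mult)

lemma ip_zero_left [simp]: "ip 0 y = 0"
  using ip_add_left[of 0 0 y] by simp

lemma ip_zero_right [simp]: "ip x 0 = 0"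
  using ip_add_right[of x 0 0] by simp

lemma ip_diff_left: "ip (x - y) z = ip x z - ip y z"
  using ip_add_left[of "x - y" y z] by (simp add: algebra_simps)

lemma ip_diff_right: "ip x (y - z) = ip x y - ip x z"
  using ip_add_right[of x "y - z" z] by (simp add: algebra_simps)

lemma ip_eq_0_commute: "ip x y = 0 \<longleftrightarrow> ip y x = 0"
  by (metis ip_commute kconj_0)

lemma ip_self_eq_0 [simp]: "ip x x = 0 \<longleftrightarrow> x = 0"
  by (simp add: ip_norm)

lemma ip_right_unique: "(\<And>x. ip x y = ip x z) \<Longrightarrow> y = z"
  by (metis ip_diff_right ip_self_eq_0 eq_iff_diff_eq_0)

lemma pythagoras:
  assumes "ip x y = 0"
  shows "(norm (x + y))\<^sup>2 = (norm x)\<^sup>2 + (norm y)\<^sup>2"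
proof -
  have "of_real ((norm (x + y))\<^sup>2) = (of_real ((norm x)\<^sup>2 + (norm y)\<^sup>2) :: 'k)"
    unfolding of_real_add ip_norm[symmetric]
    using assms ip_eq_0_commute[of x y] by (simp add: ip_add_left ip_add_right)
  then show ?thesis by (simp only: of_real_eq_iff)
qed

lemma parallelogram:
  fixes x y :: 'a
  shows "(norm (x + y))\<^sup>2 + (norm (x - y))\<^sup>2 = 2 * (norm x)\<^sup>2 + 2 * (norm y)\<^sup>2"
proof -
  have "of_real ((norm (x + y))\<^sup>2 + (norm (x - y))\<^sup>2)
      = (of_real ((norm x)\<^sup>2 + (norm x)\<^sup>2 + (norm y)\<^sup>2 + (norm y)\<^sup>2) :: 'k)"
    unfolding of_real_add ip_norm[symmetric]
    by (simp only: ip_add_left ip_add_right ip_diff_left ip_diff_right) simp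
  then show ?thesis unfolding of_real_eq_iff by simp
qed

lemma norm_scale: "norm (scale c x) = norm c * norm x"
proof -
  have "of_real ((norm (scale c x))\<^sup>2) = c * kconj c * ip x x"
    unfolding ip_norm[symmetric] by (simp add: ip_scale_left ip_scale_right)
  also have "\<dots> = of_real ((norm c * norm x)\<^sup>2)"
    by (simp add: mult_kconj ip_norm scaleR_conv_of_real power_mult_distrib)
  finally have "(norm (scale c x))\<^sup>2 = (norm c * norm x)\<^sup>2"
    by (simp only: of_real_eq_iff)
  then show ?thesis by (simp add: power2_eq_iff_nonneg)
qed

text \<open>
  The vector \<open>scale c v\<close> is the orthogonal projection of \<open>u\<close> onto the line through \<open>v\<close>. Both the
  Cauchy-Schwarz inequality and the orthogonality of distance minimisers follow from this
  Pythagorean decomposition of \<open>u\<close>.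
\<close>

lemma component_along:
  fixes u v :: 'a
  assumes "v \<noteq> 0"
  defines "c \<equiv> ip u v / of_real ((norm v)\<^sup>2)"
  shows "ip (scale c v) v = ip u v"
    and "(norm u)\<^sup>2 = (norm (u - scale c v))\<^sup>2 + (norm (scale c v))\<^sup>2"
proof -
  show 1: "ip (scale c v) v = ip u v"
    using assms by (simp add: ip_scale_left ip_norm)
  have "ip (u - scale c v) (scale c v) = 0"
    by (simp add: ip_scale_right ip_diff_left 1)
  from pythagoras[OF this]
  show "(norm u)\<^sup>2 = (norm (u - scale c v))\<^sup>2 + (norm (scale c v))\<^sup>2" by simp
qed

lemma Cauchy_Schwarz: "norm (ip u v) \<le> norm u * norm v"
proof (cases "v = 0")
  case False
  define c where "c = ip u v / of_real ((norm v)\<^sup>2)"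
  have "(norm (scale c v))\<^sup>2 \<le> (norm u)\<^sup>2"
    using component_along(2)[OF False, where u = u] by (simp add: c_def)
  then have "norm (scale c v) \<le> norm u"
    by (rule power2_le_imp_le) simp
  moreover have "norm (scale c v) * norm v = norm (ip u v)"
    using False by (simp add: norm_scale c_def norm_divide norm_mult power2_eq_square)
  ultimately show ?thesis
    by (metis mult_right_mono norm_ge_zero)
qed simp

lemma minimal_imp_orthogonal:
  assumes "\<And>c. norm u \<le> norm (u - scale c v)"
  shows "ip u v = 0"
proof (cases "v = 0")
  case False
  define c where "c = ip u v / of_real ((norm v)\<^sup>2)"
  have "(norm u)\<^sup>2 \<le> (norm (u - scale c v))\<^sup>2"
    using assms by (simp add: power_mono)
  then have "(norm (scale c v))\<^sup>2 \<le> 0"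
    using component_along(2)[OF False, where u = u] by (simp add: c_def)
  then have "scale c v = 0" by (simp only: power2_less_eq_zero_iff norm_eq_zero)
  then show ?thesis
    using component_along(1)[OF False, where u = u] unfolding c_def by (metis ip_zero_left)
qed simp

lemma bounded_linear_ip_left: "bounded_linear (\<lambda>x. ip x y)"
proof (rule bounded_linear_intro)
  show "ip (r *\<^sub>R x) y = r *\<^sub>R ip x y" for r x
    using ip_scale_left[of "of_real r" x y] by (simp add: scale_of_real scaleR_conv_of_real)
  show "norm (ip x y) \<le> norm x * norm y" for x
    by (rule Cauchy_Schwarz)
qed (rule ip_add_left)

lemma bounded_linear_ip_right: "bounded_linear (ip x)"
proof (rule bounded_linear_intro)
  show "ip x (r *\<^sub>R y) = r *\<^sub>R ip x y" for r y
    using ip_scale_right[of x "of_real r" y] by (simp add: scale_of_real scaleR_conv_of_real)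
  show "norm (ip x y) \<le> norm y * norm x" for y
    using Cauchy_Schwarz[of x y] by (simp add: mult.commute)
qed (simp_all add: ip_add_right)

lemma bounded_linear_scale: "bounded_linear (scale c)"
proof (rule bounded_linear_intro)
  show "scale c (r *\<^sub>R x) = r *\<^sub>R scale c x" for r x
    by (simp add: scale_of_real[symmetric] scale_left_commute)
  show "norm (scale c x) \<le> norm x * norm c" for x
    by (simp add: norm_scale mult.commute)
qed (simp add: scale_right_distrib)

lemma closure_subspace:
  assumes "subspace R"
  shows "subspace (closure R)"
proof (rule subspaceI)
  show "0 \<in> closure R"
    using subspace_0[OF assms] closure_subset by blast
  show "x + y \<in> closure R" if xy: "x \<in> closure R" "y \<in> closure R" for x y
  proof -
    obtain f g where f: "\<forall>n. f n \<in> R" "f \<longlonglongrightarrow> x" and g: "\<forall>n. g n \<in> R" "g \<longlonglongrightarrow> y"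
      using xy unfolding closure_sequential by blast
    have "\<forall>n. f n + g n \<in> R"
      using f g subspace_add[OF assms] by blast
    then show ?thesis
      using tendsto_add[OF f(2) g(2)] unfolding closure_sequential
      by (intro exI[of _ "\<lambda>n. f n + g n"]) simp
  qed
  show "scale c x \<in> closure R" if x: "x \<in> closure R" for c x
  proof -
    obtain f where f: "\<forall>n. f n \<in> R" "f \<longlonglongrightarrow> x"
      using x unfolding closure_sequential by blast
    have "\<forall>n. scale c (f n) \<in> R"
      using f subspace_scale[OF assms] by blast
    then show ?thesis
      using bounded_linear.tendsto[OF bounded_linear_scale f(2)]
      unfolding closure_sequential by (intro exI[of _ "\<lambda>n. scale c (f n)"]) simp
  qed
qed

text \<open>
  By the parallelogram law a sequence in \<open>M\<close> whose distances to \<open>x\<close> tend to the infimum is a Cauchy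
  sequence; completeness supplies its limit.
\<close>

lemma closest_point_exists:
  assumes "closed M" "subspace M"
  obtains p where "p \<in> M" "\<And>m. m \<in> M \<Longrightarrow> norm (x - p) \<le> norm (x - m)"
proof -
  define d where "d = (INF m\<in>M. (norm (x - m))\<^sup>2)"
  have ne: "M \<noteq> {}" using subspace_0[OF assms(2)] by blast
  have bdd: "bdd_below ((\<lambda>m. (norm (x - m))\<^sup>2) ` M)"
    by (rule bdd_belowI[of _ 0]) auto
  have d_le: "d \<le> (norm (x - m))\<^sup>2" if "m \<in> M" for m
    unfolding d_def using bdd that by (rule cINF_lower)
  have "\<exists>m\<in>M. (norm (x - m))\<^sup>2 < d + e" if "e > 0" for e
    using cINF_less_iff[OF ne bdd, of "d + e"] that by (simp add: d_def)
  then have "\<forall>n. \<exists>m\<in>M. (norm (x - m))\<^sup>2 < d + inverse (real (Suc n))"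
    by simp
  then obtain f where fM: "\<And>n. f n \<in> M"
    and f: "\<And>n. (norm (x - f n))\<^sup>2 < d + inverse (real (Suc n))"
    by metis
  \<comment> \<open>The parallelogram law for \<open>x - f i\<close> and \<open>x - f j\<close>, whose half sum is \<open>x\<close> minus the
    midpoint of \<open>f i\<close> and \<open>f j\<close>.\<close>
  have close: "(norm (f i - f j))\<^sup>2 \<le> 2 * inverse (real (Suc i)) + 2 * inverse (real (Suc j))" for i j
  proof -
    define m where "m = (1/2) *\<^sub>R (f i + f j)"
    have "m \<in> M"
      unfolding m_def scale_of_real[symmetric]
      using fM assms(2) by (simp add: subspace_add subspace_scale)
    moreover have "(x - f i) + (x - f j) = 2 *\<^sub>R (x - m)"
      unfolding m_def by (simp add: algebra_simps scaleR_2)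
    then have "(norm ((x - f i) + (x - f j)))\<^sup>2 = 4 * (norm (x - m))\<^sup>2"
      by (simp add: power2_eq_square)
    moreover have "norm ((x - f i) - (x - f j)) = norm (f i - f j)"
      by (simp add: norm_minus_commute)
    ultimately have "(norm (f i - f j))\<^sup>2
        \<le> 2 * (norm (x - f i))\<^sup>2 + 2 * (norm (x - f j))\<^sup>2 - 4 * d"
      using parallelogram[of "x - f i" "x - f j"] d_le[of m] by simp
    with f[of i] f[of j] show ?thesis by linarith
  qed
  have "Cauchy f"
  proof (rule metric_CauchyI)
    fix e :: real
    assume e: "e > 0"
    then obtain n where n: "inverse (real (Suc n)) < e\<^sup>2 / 4"
      using reals_Archimedean[of "e\<^sup>2 / 4"] by auto
    have "dist (f i) (f j) < e" if "i \<ge> n" "j \<ge> n" for i j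
    proof -
      have "inverse (real (Suc i)) \<le> inverse (real (Suc n))"
        "inverse (real (Suc j)) \<le> inverse (real (Suc n))"
        using that by (simp_all add: le_imp_inverse_le)
      then have "(norm (f i - f j))\<^sup>2 < e\<^sup>2"
        using close[of i j] n by linarith
      then show ?thesis
        using e by (simp add: dist_norm power2_less_imp_less)
    qed
    then show "\<exists>N. \<forall>m\<ge>N. \<forall>n\<ge>N. dist (f m) (f n) < e" by blast
  qed
  then obtain p where p: "f \<longlonglongrightarrow> p"
    using Cauchy_convergent_iff convergent_def by blast
  show ?thesis
  proof
    show "p \<in> M"
      using closed_sequentially[OF assms(1)] fM p by blast
    have "(\<lambda>n. d + inverse (real (Suc n))) \<longlonglongrightarrow> d + 0"
      by (intro tendsto_intros LIMSEQ_inverse_real_of_nat)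
    moreover have "(\<lambda>n. (norm (x - f n))\<^sup>2) \<longlonglongrightarrow> (norm (x - p))\<^sup>2"
      by (intro tendsto_intros p)
    ultimately have "(norm (x - p))\<^sup>2 \<le> d"
      using LIMSEQ_le[of "\<lambda>n. (norm (x - f n))\<^sup>2"] less_imp_le[OF f] by auto
    then show "norm (x - p) \<le> norm (x - m)" if "m \<in> M" for m
      using d_le[OF that] by (meson norm_ge_zero order_trans power2_le_imp_le)
  qed
qed

lemma orthogonal_projection:
  assumes "closed M" "subspace M"
  obtains p where "p \<in> M" "x - p \<in> orth_compl ip M"
proof -
  obtain p where p: "p \<in> M" "\<And>m. m \<in> M \<Longrightarrow> norm (x - p) \<le> norm (x - m)"
    using closest_point_exists[OF assms] by blast
  have "ip (x - p) v = 0" if "v \<in> M" for v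
  proof (rule minimal_imp_orthogonal)
    fix c
    have "p + scale c v \<in> M"
      using p(1) that assms(2) by (simp add: subspace_add subspace_scale)
    from p(2)[OF this] show "norm (x - p) \<le> norm (x - p - scale c v)"
      by (simp add: diff_diff_eq)
  qed
  with p(1) show ?thesis
    by (intro that) (auto simp: orth_compl_def)
qed

text \<open>
  If \<open>p\<close> is the projection of \<open>z\<close> onto \<open>closure R\<close>, then \<open>z - p\<close> is orthogonal to \<open>R\<close>, hence to
  \<open>z\<close>; it is also orthogonal to \<open>p\<close>, and so to itself.
\<close>

lemma double_orth_compl_subset_closure:
  assumes "subspace R"
  shows "orth_compl ip (orth_compl ip R) \<subseteq> closure R"
proof
  fix z
  assume z: "z \<in> orth_compl ip (orth_compl ip R)"
  obtain p where p: "p \<in> closure R" "z - p \<in> orth_compl ip (closure R)"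
    by (rule orthogonal_projection[OF closed_closure closure_subspace[OF assms]])
  have "z - p \<in> orth_compl ip R"
    using p(2) closure_subset[of R] by (auto simp: orth_compl_def)
  then have "ip z (z - p) = 0"
    using z by (auto simp: orth_compl_def)
  moreover have "ip p (z - p) = 0"
    using p ip_eq_0_commute[of p "z - p"] by (simp add: orth_compl_def)
  ultimately have "ip (z - p) (z - p) = 0"
    by (simp add: ip_diff_left)
  then have "z = p" by simp
  with p(1) show "z \<in> closure R" by simp
qed

text \<open>
  A nonzero functional is determined by its kernel and its value at one vector \<open>w\<close> orthogonal to
  the kernel; the representing vector is a multiple of \<open>w\<close>.
\<close>

lemma Riesz_representation:
  assumes "bounded_linear f" and scale: "\<And>c x. f (scale c x) = c * f x"
  obtains u where "\<And>x. f x = ip x u"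
proof (cases "\<exists>x. f x \<noteq> 0")
  case False
  then show ?thesis by (intro that[of 0]) simp
next
  case True
  interpret f: bounded_linear f by fact
  obtain x0 where x0: "f x0 \<noteq> 0" using True by blast
  define K where "K = {x. f x = 0}"
  have "closed K"
    unfolding K_def by (intro closed_Collect_eq continuous_intros f.continuous_on)
  moreover have "subspace K"
    by (rule subspaceI) (simp_all add: K_def f.add f.zero scale)
  ultimately obtain p where p: "p \<in> K" "x0 - p \<in> orth_compl ip K"
    by (rule orthogonal_projection)
  define w where "w = x0 - p"
  have fw: "f w \<noteq> 0"
    using p(1) x0 by (simp add: w_def K_def f.diff)
  then have w: "w \<noteq> 0" using f.zero by auto
  show ?thesis
  proof
    fix x
    have "x - scale (f x / f w) w \<in> K"
      using fw by (simp add: K_def f.diff scale)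
    then have "ip (x - scale (f x / f w) w) w = 0"
      using p(2) ip_eq_0_commute[of _ w] by (simp add: w_def[symmetric] orth_compl_def)
    then have "ip x w = f x / f w * ip w w"
      by (simp add: ip_diff_left ip_scale_left)
    then show "f x = ip x (scale (kconj (f w / ip w w)) w)"
      using fw w by (simp add: ip_scale_right)
  qed
qed

end

section \<open>Uniform boundedness\<close>

text \<open>
  The closed sets on which all \<open>f i\<close> are bounded by \<open>n\<close> cover the space, so by Baire's theorem one
  of them contains a ball \<open>cball a r\<close>. By linearity, subtracting the value at \<open>a\<close> moves the bound
  to a ball around the origin at the cost of a factor 2.
\<close>

lemma Banach_Steinhaus:
  fixes f :: "'i \<Rightarrow> 'a::banach \<Rightarrow> 'b::real_normed_vector"
  assumes lin: "\<And>i. i \<in> I \<Longrightarrow> bounded_linear (f i)"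
    and pointwise: "\<And>x. \<exists>c. \<forall>i\<in>I. norm (f i x) \<le> c"
  obtains C where "\<And>i x. i \<in> I \<Longrightarrow> norm (f i x) \<le> C * norm x"
proof -
  define E where "E n = {x. \<forall>i\<in>I. norm (f i x) \<le> real n}" for n
  have closed: "closed (E n)" for n
  proof -
    have "closed {x. norm (f i x) \<le> real n}" if "i \<in> I" for i
      by (rule closed_Collect_le)
        (rule continuous_on_norm linear_continuous_on lin that continuous_on_const)+
    moreover have "E n = (\<Inter>i\<in>I. {x. norm (f i x) \<le> real n})"
      by (auto simp: E_def)
    ultimately show ?thesis
      by (simp add: closed_INT)
  qed
  have cover: "(\<Union>n. E n) = UNIV"
  proof (intro set_eqI iffI UNIV_I)
    fix x
    obtain c where c: "\<forall>i\<in>I. norm (f i x) \<le> c" using pointwise by blast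
    obtain n where "c \<le> real n" using real_arch_simple by blast
    with c have "x \<in> E n" by (force simp: E_def)
    then show "x \<in> (\<Union>n. E n)" by blast
  qed
  have "\<exists>n. interior (E n) \<noteq> {}"
  proof (rule ccontr)
    assume "\<not> ?thesis"
    then have "(euclidean::'a topology) interior_of \<Union>(range E) = {}"
      by (intro Baire_category_alt)
        (auto simp: completely_metrizable_space_euclidean closed)
    then show False by (simp add: cover)
  qed
  then obtain n a where "a \<in> interior (E n)" by blast
  then obtain r where r: "r > 0" "cball a r \<subseteq> E n"
    using mem_interior_cball by blast
  show ?thesis
  proof
    fix i x
    assume i: "i \<in> I"
    interpret fi: bounded_linear "f i" using lin[OF i] .
    show "norm (f i x) \<le> (2 * real n / r) * norm x"
    proof (cases "x = 0")
      case False
      define y where "y = (r / norm x) *\<^sub>R x"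
      have "a + y \<in> E n" "a \<in> E n"
        using False r(1) by (auto intro!: subsetD[OF r(2)] simp: y_def dist_norm)
      then have "norm (f i (a + y)) \<le> real n" "norm (f i a) \<le> real n"
        using i by (auto simp: E_def)
      then have "norm (f i y) \<le> 2 * real n"
        using norm_triangle_ineq4[of "f i (a + y)" "f i a"] by (simp add: fi.add)
      then show ?thesis
        using False r(1) by (simp add: y_def fi.scaleR field_simps)
    qed (simp add: fi.zero)
  qed
qed

section \<open>Adjoints and Douglas's theorem\<close>

locale two_hilbert_spaces = H1: hilbert_space scale1 ip1 + H2: hilbert_space scale2 ip2
  for scale1 :: "'k::real_or_complex \<Rightarrow> 'a::banach \<Rightarrow> 'a"
    and ip1 :: "'a \<Rightarrow> 'a \<Rightarrow> 'k"
    and scale2 :: "'k \<Rightarrow> 'b::banach \<Rightarrow> 'b"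
    and ip2 :: "'b \<Rightarrow> 'b \<Rightarrow> 'k"
begin

text \<open>
  This defining property justifies the definite description in \<^const>\<open>adj\<close>: the Riesz theorem,
  applied to \<open>x \<mapsto> \<langle>A x, y\<rangle>\<close> for each \<open>y\<close>, gives existence.
\<close>

lemma ip_adj:
  assumes "bounded_op scale1 scale2 A"
  shows "ip2 (A x) y = ip1 x (adj ip1 ip2 A y)"
proof -
  have A: "bounded_linear A" "\<And>c x. A (scale1 c x) = scale2 c (A x)"
    using assms by (auto simp: bounded_op_def)
  have "\<exists>u. \<forall>x. ip2 (A x) y = ip1 x u" for y
  proof -
    have "bounded_linear (\<lambda>x. ip2 (A x) y)"
      using bounded_linear_compose[OF H2.bounded_linear_ip_left A(1)] .
    then show ?thesis
      using H1.Riesz_representation[of "\<lambda>x. ip2 (A x) y"]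
      by (metis A(2) H2.ip_scale_left)
  qed
  then obtain A' where A': "\<forall>x y. ip2 (A x) y = ip1 x (A' y)" by metis
  have "adj ip1 ip2 A = A'"
    unfolding adj_def
  proof (rule the_equality, fact A')
    fix B'
    assume "\<forall>x y. ip2 (A x) y = ip1 x (B' y)"
    with A' show "B' = A'" by (intro ext H1.ip_right_unique) metis
  qed
  with A' show ?thesis by simp
qed

lemma subspace_range_adj:
  assumes "bounded_op scale1 scale2 A"
  shows "H1.subspace (range (adj ip1 ip2 A))"
proof (rule H1.subspaceI)
  note adj = ip_adj[OF assms, symmetric]
  have "adj ip1 ip2 A 0 = 0"
    by (rule H1.ip_right_unique) (simp add: adj)
  then show "0 \<in> range (adj ip1 ip2 A)" by (metis rangeI)
next
  note adj = ip_adj[OF assms, symmetric]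
  fix x y
  assume "x \<in> range (adj ip1 ip2 A)" "y \<in> range (adj ip1 ip2 A)"
  then obtain u v where uv: "x = adj ip1 ip2 A u" "y = adj ip1 ip2 A v" by blast
  have "adj ip1 ip2 A (u + v) = x + y"
    by (rule H1.ip_right_unique) (simp add: uv adj H1.ip_add_right H2.ip_add_right)
  then show "x + y \<in> range (adj ip1 ip2 A)" by (metis rangeI)
next
  note adj = ip_adj[OF assms, symmetric]
  fix c x
  assume "x \<in> range (adj ip1 ip2 A)"
  then obtain u where u: "x = adj ip1 ip2 A u" by blast
  have "adj ip1 ip2 A (scale2 c u) = scale1 c x"
    by (rule H1.ip_right_unique) (simp add: u adj H1.ip_scale_right H2.ip_scale_right)
  then show "scale1 c x \<in> range (adj ip1 ip2 A)" by (metis rangeI)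
qed

lemma null_space_eq_orth_compl_range_adj:
  assumes "bounded_op scale1 scale2 A"
  shows "null_space A = orth_compl ip1 (range (adj ip1 ip2 A))"
  by (auto simp: null_space_def orth_compl_def ip_adj[OF assms, symmetric])
    (metis H2.ip_self_eq_0)

text \<open>
  Since \<open>\<langle>S z, y\<rangle> = \<langle>z, S\<^sup>* y\<rangle>\<close>, the hypothesis bounds the functional \<open>\<langle>z, _\<rangle>\<close> by \<open>K\<close> on the
  range of \<open>S\<^sup>*\<close>. That range is dense in the orthogonal complement of the null space of \<open>S\<close>, which
  contains \<open>z\<close>, so the bound may be evaluated at \<open>z\<close> itself.
\<close>

lemma norm_le_of_orth_null_space:
  assumes S: "bounded_op scale1 scale2 S"
    and z: "z \<in> orth_compl ip1 (null_space S)"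
    and "K \<ge> 0"
    and bound: "\<And>y. norm (ip2 (S z) y) \<le> K * norm (adj ip1 ip2 S y)"
  shows "norm z \<le> K"
proof (cases "z = 0")
  case True
  with assms(3) show ?thesis by simp
next
  case False
  have "z \<in> closure (range (adj ip1 ip2 S))"
    using z H1.double_orth_compl_subset_closure[OF subspace_range_adj[OF S]]
    by (auto simp: null_space_eq_orth_compl_range_adj[OF S])
  then obtain p where p: "\<forall>n. p n \<in> range (adj ip1 ip2 S)" "p \<longlonglongrightarrow> z"
    unfolding closure_sequential by blast
  have "norm (ip1 z (p n)) \<le> K * norm (p n)" for n
    using p(1) bound ip_adj[OF S, of z] by (metis imageE)
  moreover have "(\<lambda>n. norm (ip1 z (p n))) \<longlonglongrightarrow> norm (ip1 z z)"
    by (intro tendsto_norm bounded_linear.tendsto[OF H1.bounded_linear_ip_right p(2)])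
  moreover have "(\<lambda>n. K * norm (p n)) \<longlonglongrightarrow> K * norm z"
    by (intro tendsto_intros p)
  ultimately have "norm (ip1 z z) \<le> K * norm z"
    by (meson LIMSEQ_le)
  then have "norm z * norm z \<le> K * norm z"
    by (simp add: H1.ip_norm norm_mult power2_eq_square)
  with False show ?thesis by simp
qed

text \<open>
  \<open>S\<close> is injective on \<open>N\<close>, the orthogonal complement of its null space, and projecting any preimage of
  \<open>A x\<close> into \<open>N\<close> gives another preimage. So there is exactly one candidate \<open>Z x\<close>, and every
  identity for \<open>Z\<close> can be checked after applying \<open>S\<close>. Only its boundedness needs an analytic
  argument.
\<close>

lemma douglas_solution_ex1:
  fixes A :: "'g::banach \<Rightarrow> 'b" and S :: "'a \<Rightarrow> 'b"
  assumes S: "bounded_op scale1 scale2 S" and A: "bounded_op scaleG scale2 A"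
    and range: "range A \<subseteq> range S"
  shows "\<exists>!C. bounded_op scaleG scale1 C \<and> A = S \<circ> C
    \<and> range C \<subseteq> orth_compl ip1 (null_space S)"
proof -
  define N where "N = orth_compl ip1 (null_space S)"
  have S': "bounded_linear S" "\<And>c x. S (scale1 c x) = scale2 c (S x)"
    and A': "bounded_linear A" "\<And>c x. A (scaleG c x) = scale2 c (A x)"
    using S A by (auto simp: bounded_op_def)
  interpret S: bounded_linear S by fact
  interpret A: bounded_linear A by fact
  have N_add: "u + v \<in> N" if "u \<in> N" "v \<in> N" for u v
    using that by (simp add: N_def orth_compl_def H1.ip_add_left)
  have N_scale: "scale1 c u \<in> N" if "u \<in> N" for u c
    using that by (simp add: N_def orth_compl_def H1.ip_scale_left)
  have N_inj: "u = v" if "u \<in> N" "v \<in> N" "S u = S v" for u v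
  proof -
    have "u - v \<in> null_space S"
      using that(3) by (simp add: null_space_def S.diff)
    then have "ip1 u (u - v) = 0" "ip1 v (u - v) = 0"
      using that(1,2) by (auto simp: N_def orth_compl_def)
    then have "ip1 (u - v) (u - v) = 0" by (simp add: H1.ip_diff_left)
    then show ?thesis by simp
  qed
  have "\<exists>z\<in>N. S z = A x" for x
  proof -
    obtain w where w: "S w = A x" using range by (metis rangeE rangeI subsetD)
    have "closed (null_space S)"
      unfolding null_space_def by (intro closed_Collect_eq continuous_intros S.continuous_on)
    moreover have "H1.subspace (null_space S)"
      by (rule H1.subspaceI) (simp_all add: null_space_def S.add S.zero S'(2))
    ultimately obtain p where "p \<in> null_space S" "w - p \<in> N"
      unfolding N_def by (rule H1.orthogonal_projection)
    with w show ?thesis by (intro bexI[of _ "w - p"]) (simp_all add: null_space_def S.diff)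
  qed
  then obtain Z where ZN: "\<And>x. Z x \<in> N" and SZ: "\<And>x. S (Z x) = A x" by metis
  have Z_add: "Z (x + y) = Z x + Z y" for x y
    by (rule N_inj) (simp_all add: N_add ZN SZ S.add A.add)
  have Z_scale: "Z (scaleG c x) = scale1 c (Z x)" for c x
    by (rule N_inj) (auto simp: N_scale ZN SZ S'(2) A'(2))
  have Z_scaleR: "Z (r *\<^sub>R x) = r *\<^sub>R Z x" for r x
  proof (rule N_inj)
    show "r *\<^sub>R Z x \<in> N"
      unfolding H1.scale_of_real[symmetric] using N_scale ZN by blast
  qed (simp_all add: ZN SZ S.scaleR A.scaleR)
  \<comment> \<open>Seen through this identity, the functionals \<open>x \<mapsto> \<langle>Z x, S\<^sup>* y\<rangle>\<close> are continuous before anything is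
    known about the continuity of \<open>Z\<close>.\<close>
  have pairing: "ip2 (A x) y = ip1 (Z x) (adj ip1 ip2 S y)" for x y
    using ip_adj[OF S] by (simp add: SZ[symmetric])
  define I where "I = {y. norm (adj ip1 ip2 S y) \<le> 1}"
  obtain C where C: "\<And>y x. y \<in> I \<Longrightarrow> norm (ip2 (A x) y) \<le> C * norm x"
  proof (rule Banach_Steinhaus[of I "\<lambda>y x. ip2 (A x) y"])
    show "bounded_linear (\<lambda>x. ip2 (A x) y)" for y
      using bounded_linear_compose[OF H2.bounded_linear_ip_left A'(1)] .
    show "\<exists>c. \<forall>y\<in>I. norm (ip2 (A x) y) \<le> c" for x
    proof (intro exI ballI)
      fix y
      assume "y \<in> I"
      then have "norm (Z x) * norm (adj ip1 ip2 S y) \<le> norm (Z x) * 1"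
        by (intro mult_left_mono) (simp_all add: I_def)
      then show "norm (ip2 (A x) y) \<le> norm (Z x)"
        using H1.Cauchy_Schwarz[of "Z x" "adj ip1 ip2 S y"] by (simp add: pairing)
    qed
  qed blast
  have Z_bound: "norm (Z x) \<le> norm x * \<bar>C\<bar>" for x
  proof (rule norm_le_of_orth_null_space[OF S])
    show "Z x \<in> orth_compl ip1 (null_space S)"
      using ZN by (simp add: N_def)
    show "0 \<le> norm x * \<bar>C\<bar>" by simp
    fix y
    define t where "t = norm (adj ip1 ip2 S y)"
    show "norm (ip2 (S (Z x)) y) \<le> norm x * \<bar>C\<bar> * norm (adj ip1 ip2 S y)"
    proof (cases "t = 0")
      case True
      then show ?thesis by (simp add: SZ pairing t_def)
    next
      case False
      then have t: "t > 0" by (simp add: t_def)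
      \<comment> \<open>Rescale \<open>y\<close> so that its image under the adjoint has norm 1 and \<open>C\<close> applies.\<close>
      define v where "v = scale2 (of_real (inverse t)) y"
      have ip_v: "ip2 u v = of_real (inverse t) * ip2 u y" for u
        by (simp only: v_def H2.ip_scale_right kconj_of_real)
      have adj_v: "adj ip1 ip2 S v = scale1 (of_real (inverse t)) (adj ip1 ip2 S y)"
        by (rule H1.ip_right_unique)
          (simp only: ip_adj[OF S, symmetric] ip_v H1.ip_scale_right kconj_of_real)
      have "norm (adj ip1 ip2 S v) = 1"
        using t unfolding adj_v H1.norm_scale t_def[symmetric] norm_of_real by simp
      then have "norm (ip2 (A x) v) \<le> C * norm x"
        by (intro C) (simp add: I_def)
      also have "\<dots> \<le> norm x * \<bar>C\<bar>"
        by (subst mult.commute, rule mult_left_mono) simp_all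
      finally have "norm (ip2 (A x) y) \<le> norm x * \<bar>C\<bar> * t"
        using t unfolding ip_v norm_mult norm_of_real by (simp add: field_simps)
      then show ?thesis by (simp add: SZ t_def)
    qed
  qed
  have "bounded_op scaleG scale1 Z"
    unfolding bounded_op_def
    using bounded_linear_intro[of Z, OF Z_add Z_scaleR Z_bound] Z_scale by blast
  show ?thesis
    unfolding N_def[symmetric]
  proof (rule ex1I[of _ Z])
    show "bounded_op scaleG scale1 Z \<and> A = S \<circ> Z \<and> range Z \<subseteq> N"
      using \<open>bounded_op scaleG scale1 Z\<close> ZN by (auto simp: SZ)
    show "D = Z" if "bounded_op scaleG scale1 D \<and> A = S \<circ> D \<and> range D \<subseteq> N" for D
    proof
      fix x
      have "S (D x) = A x" "D x \<in> N" using that by auto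
      then show "D x = Z x" using N_inj ZN SZ by metis
    qed
  qed
qed

lemma douglas_solution_solves:
  fixes A :: "'g::banach \<Rightarrow> 'b" and S :: "'a \<Rightarrow> 'b"
  assumes "bounded_op scale1 scale2 S" "bounded_op scaleG scale2 A" "range A \<subseteq> range S"
  shows "S (douglas_solution scaleG scale1 ip1 S A x) = A x"
proof -
  have "A = S \<circ> douglas_solution scaleG scale1 ip1 S A"
    using theI'[OF douglas_solution_ex1[OF assms]]
    unfolding douglas_solution_def[symmetric] by (elim conjE)
  from fun_cong[OF this, of x] show ?thesis by simp
qed

section \<open>The parallel sum\<close>

lemma bounded_op_add:
  assumes "bounded_op scale1 scale2 A" "bounded_op scale1 scale2 B"
  shows "bounded_op scale1 scale2 (\<lambda>x. A x + B x)"
  using assms by (simp add: bounded_op_def bounded_linear_add H2.scale_right_distrib)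

text \<open>The reason is \<open>\<langle>A x, A x\<rangle> = \<langle>x, A\<^sup>* A x\<rangle>\<close>.\<close>

lemma adj_eq_0_imp_eq_0:
  assumes "bounded_op scale1 scale2 A" "adj ip1 ip2 A (A x) = 0"
  shows "A x = 0"
  using ip_adj[OF assms(1), of x "A x"] assms(2) by simp

text \<open>
  For \<open>z = Z x\<close> the equation \<open>A z + B z = A x\<close> turns \<open>(2 A + B) z\<close> into \<open>A (z + x)\<close>, a vector in the
  range of \<open>A\<close>. Such a vector is annihilated by \<open>A\<^sup>*\<close> only if it is zero, so \<open>A Z = - A\<close>.
\<close>

lemma parallel_sum_eq_double:
  assumes A: "bounded_op scale1 scale2 A" and B: "bounded_op scale1 scale2 B"
    and range: "range A \<subseteq> range (\<lambda>x. A x + B x)"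
    and adj: "\<And>x. adj ip1 ip2 A (2 *\<^sub>R A x + B x) = 0"
  shows "parallel_sum scale1 ip1 A B x = 2 *\<^sub>R A x"
proof -
  interpret A: bounded_linear A using A by (simp add: bounded_op_def)
  interpret B: bounded_linear B using B by (simp add: bounded_op_def)
  define z where "z = douglas_solution scale1 scale1 ip1 (\<lambda>x. A x + B x) A x"
  have z: "A z + B z = A x"
    unfolding z_def using douglas_solution_solves[OF bounded_op_add[OF A B] A range] .
  have "2 *\<^sub>R A z + B z = A (z + x)"
    by (simp add: A.add z[symmetric] scaleR_2 add.assoc)
  then have "A (z + x) = 0"
    using adj[of z] adj_eq_0_imp_eq_0[OF A] by metis
  then have "A z = - A x"
    by (simp add: A.add eq_neg_iff_add_eq_0)
  then show ?thesis
    by (simp add: parallel_sum_eq[of A B, OF A.zero B.zero] z_def[symmetric] scaleR_2)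
qed

end

lemma norm_Pair_diag: "norm (u, u) = sqrt 2 * norm u"
  by (simp add: norm_Pair real_sqrt_mult flip: mult_2)

theorem theorem4p1:
  fixes scale1 :: "'k::real_or_complex \<Rightarrow> 'a::banach \<Rightarrow> 'a"
    and ip1 :: "'a \<Rightarrow> 'a \<Rightarrow> 'k"
    and scale2 :: "'k \<Rightarrow> 'b::banach \<Rightarrow> 'b"
    and ip2 :: "'b \<Rightarrow> 'b \<Rightarrow> 'k"
    and A B :: "'a \<Rightarrow> 'b"
  assumes "hilbert_space scale1 ip1" and "hilbert_space scale2 ip2"
    and "bounded_op scale1 scale2 A" and "bounded_op scale1 scale2 B"
    and "complementable ip2 ip1 ip2 (parallel_block A B)"
    and "\<forall>x. adj ip1 ip2 A (2 *\<^sub>R A x + B x) = 0"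
  shows "\<forall>x \<in> UNIV \<times> {0}.
    norm (parallel_sum scale1 ip1 A B (fst x)) \<ge> norm (parallel_block A B x)"
proof
  fix x :: "'a \<times> 'a"
  assume "x \<in> UNIV \<times> {0}"
  then obtain u where x: "x = (u, 0)" by auto
  interpret two_hilbert_spaces scale1 ip1 scale2 ip2
    using assms(1,2) by (simp add: two_hilbert_spaces_def)
  have zero: "A 0 = 0" "B 0 = 0"
    using assms(3,4) by (auto simp: bounded_op_def linear_simps)
  have "range A \<subseteq> range (\<lambda>x. A x + B x)"
    using assms(5) complementable_parallel_block[of A B, OF zero] by blast
  then have "parallel_sum scale1 ip1 A B u = 2 *\<^sub>R A u"
    using parallel_sum_eq_double assms(3,4,6) by blast
  moreover have "parallel_block A B x = (A u, A u)"
    by (simp add: x parallel_block_def block_op_def zero)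
  moreover have "sqrt 2 * norm (A u) \<le> 2 * norm (A u)"
    by (intro mult_right_mono) (simp_all add: real_le_lsqrt)
  ultimately show "norm (parallel_sum scale1 ip1 A B (fst x)) \<ge> norm (parallel_block A B x)"
    by (simp add: x norm_Pair_diag)
qed

end
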